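(* Let $X$ be a random element of a sample space $\mathcal{X}$, let $G$ be a finite group (under composition) of transformations $g:\mathcal{X}\to\mathcal{X}$, and let $T:\mathcal{X}\to\mathbb{R}$ be a test statistic. Assume that the null hypothesis $H_{\mathrm p}$ holds, i.e. the joint distribution of $(T(aX))_{a\in G}$ equals that of $(T(agX))_{a\in G}$ for every $g\in G$. Suppose moreover that there is a partition $\{G_1,\dots,G_m\}$ of $G$ with $\mathrm{id}\in G_1$ and $\#G_1=\dots=\#G_m$, such that (under $H_{\mathrm p}$) with probability $1$, for all $g,g'\in G$, $T(gX)=T(g'X)$ if and only if $g$ and $g'$ lie in the same set $G_i$. Let $h_1\in G_1,\dots,h_m\in G_m$ be fixed elements. Let $w\ge 1$ be an integer, $g_1=\mathrm{id}$, and let $g_2,\dots,g_w$ be random transformations, independent of $X$, drawn uniformly either (i) with replacement from $\{h_1,\dots,h_m\}$, or (ii) without replacement from $\{h_2,\dots,h_m\}$ (in which case $w\le m$). For $\alpha\in[0,1)$ put $k'=\lceil(1-\alpha)w\rceil$, let $T^{(1)}(X,G')\le\dots\le T^{(w)}(X,G')$ be the sorted values $T(g_jX)$, $1\le j\le w$, where $G'=(g_1,\dots,g_w)$, and consider the test that rejects $H_{\mathrm p}$ if and only if $T(X)>T^{(k')}(X,G')$. Then: (a) in both cases (i) and (ii), for every $\alpha\in[0,1)$, $\mathbb{P}\{T(X)>T^{(k')}(X,G')\}\le\alpha$; (b) in case (ii), for every $\alpha\in\{0/w,1/w,\dots,(w-1)/w\}$, the test is exact, i.e. $\mathbb{P}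\{T(X)>T^{(k')}(X,G')\}=\alpha$.
   Context: $gX$ denotes $g(X)$; $\#S$ is the cardinality of $S$. All maps are assumed measurable, so that each $T(gX)$ is a random variable. $\mathrm{id}$ is the identity map $x\mapsto x$, which is the identity element of $G$. The sorted values $T(g_jX)$ are counted with multiplicity. Drawing with replacement from a finite set means independent uniform draws from it; drawing $g_2,\dots,g_w$ without replacement means that $(g_2,\dots,g_w)$ is uniformly distributed over ordered tuples of $w-1$ distinct elements of the set. *)

theory Defs
  imports "HOL-Probability.Probability" "HOL-Algebra.Bij"
begin

definition null_hypothesis ::
    "'w measure \<Rightarrow> ('w \<Rightarrow> 'x) \<Rightarrow> ('x \<Rightarrow> 'x) set \<Rightarrow> ('x \<Rightarrow> real) \<Rightarrow> bool" where
  "null_hypothesis M X G T \<longleftrightarrow>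
     (\<forall>g\<in>G. distr M (\<Pi>\<^sub>M a\<in>G. borel) (\<lambda>\<omega>. \<lambda>a\<in>G. T (a (X \<omega>)))
           = distr M (\<Pi>\<^sub>M a\<in>G. borel) (\<lambda>\<omega>. \<lambda>a\<in>G. T (a (g (X \<omega>)))))"

(* prob_space.indep_var forces both variables to have the same value type;
   this is its analogue for two value types. *)
definition indep_random_elements ::
    "'w measure \<Rightarrow> 'a measure \<Rightarrow> ('w \<Rightarrow> 'a) \<Rightarrow> 'b measure \<Rightarrow> ('w \<Rightarrow> 'b) \<Rightarrow> bool" where
  "indep_random_elements M A X B Y \<longleftrightarrow>
     X \<in> measurable M A \<and> Y \<in> measurable M B \<and>
     prob_space.indep_set M {X -` E \<inter> space M | E. E \<in> sets A}
                            {Y -` E \<inter> space M | E. E \<in> sets B}"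

definition drawn_with_replacement ::
    "'w measure \<Rightarrow> 'a set \<Rightarrow> nat set \<Rightarrow> (nat \<Rightarrow> 'w \<Rightarrow> 'a) \<Rightarrow> bool" where
  "drawn_with_replacement M H J g \<longleftrightarrow>
     prob_space.indep_vars M (\<lambda>_. count_space H) g J \<and>
     (\<forall>j\<in>J. distr M (count_space H) (g j) = uniform_count_measure H)"

definition injective_tuples :: "nat set \<Rightarrow> 'a set \<Rightarrow> (nat \<Rightarrow> 'a) set" where
  "injective_tuples J H = {t \<in> J \<rightarrow>\<^sub>E H. inj_on t J}"

definition drawn_without_replacement ::
    "'w measure \<Rightarrow> 'a set \<Rightarrow> nat set \<Rightarrow> (nat \<Rightarrow> 'w \<Rightarrow> 'a) \<Rightarrow> bool" where
  "drawn_without_replacement M H J g \<longleftrightarrow>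
     (\<lambda>\<omega>. \<lambda>j\<in>J. g j \<omega>) \<in> measurable M (count_space (injective_tuples J H)) \<and>
     distr M (count_space (injective_tuples J H)) (\<lambda>\<omega>. \<lambda>j\<in>J. g j \<omega>)
       = uniform_count_measure (injective_tuples J H)"

(* Order statistics are numbered from 1, list positions from 0. *)
definition order_statistic :: "real list \<Rightarrow> nat \<Rightarrow> real" where
  "order_statistic xs k = sort xs ! (k - 1)"

definition rejects :: "('x \<Rightarrow> real) \<Rightarrow> real \<Rightarrow> ('x \<Rightarrow> 'x) list \<Rightarrow> 'x \<Rightarrow> bool" where
  "rejects T \<alpha> gs x \<longleftrightarrow>
     T x > order_statistic (map (\<lambda>g. T (g x)) gs) (nat \<lceil>(1 - \<alpha>) * real (length gs)\<rceil>)"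

end

theory Submission
  imports Defs
begin

text \<open>Since \<open>T (a X) = T (b X)\<close> almost surely exactly when \<open>a\<close> and \<open>b\<close> lie in the same class, and the
  null hypothesis preserves this pattern under right multiplication by \<open>g\<close>, right multiplication
  permutes the classes, hence the representatives \<open>h\<^sub>i\<close>, transitively and without changing the joint
  law of their statistics. So the rejection probability does not change when the base point
  \<open>g\<^sub>1\<close> is also drawn uniformly from the representatives: \<open>(g\<^sub>1, \<dots>, g\<^sub>w)\<close> becomes
  uniform on a set of tuples that is symmetric in the positions. Every position therefore has the
  same chance of having at least \<open>k'\<close> of the values strictly below its own, and in any tuple at
  most \<open>w - k'\<close> positions (exactly that many if the values are distinct) have this property.\<close>

section \<open>Ranks of the positions of a single tuple\<close>

text \<open>Take a position of the counted set with the smallest value. At least \<open>k\<close>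
  positions have values strictly below it, and by minimality none of these is in the set, so both
  groups fit disjointly into \<open>J\<close>.\<close>

lemma card_ranks_ge_le:
  fixes u :: "'j \<Rightarrow> real"
  assumes "finite J"
  shows "card {j \<in> J. k \<le> card {i \<in> J. u i < u j}} \<le> card J - k"
proof (cases "{j \<in> J. k \<le> card {i \<in> J. u i < u j}} = {}")
  case False
  let ?B = "{j \<in> J. k \<le> card {i \<in> J. u i < u j}}"
  have finB: "finite ?B" using assms by simp
  define j where "j = arg_min_on u ?B"
  have j: "j \<in> ?B" unfolding j_def using arg_min_if_finite(1)[OF finB False] .
  have le: "u j \<le> u i" if "i \<in> ?B" for i
    unfolding j_def using arg_min_least[OF finB False that] .
  have "card ?B + card {i \<in> J. u i < u j} = card (?B \<union> {i \<in> J. u i < u j})"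
    using finB assms le by (intro card_Un_disjoint[symmetric]) force+
  also have "\<dots> \<le> card J"
    by (rule card_mono) (use assms in auto)
  finally have 1: "card ?B + card {i \<in> J. u i < u j} \<le> card J" .
  have "k \<le> card {i \<in> J. u i < u j}" using j by simp
  with 1 show ?thesis by linarith
qed (simp only: card.empty)

text \<open>At most \<open>k\<close> positions are left out: take one with the largest value; fewer
  than \<open>k\<close> values lie below it, and by injectivity all other left-out positions have
  strictly smaller values. With \<open>card_ranks_ge_le\<close> this fixes the count, also for
  \<open>k > card J\<close>, where both sides are 0.\<close>

lemma card_ranks_ge_eq:
  fixes u :: "'j \<Rightarrow> real"
  assumes "finite J" "inj_on u J"
  shows "card {j \<in> J. k \<le> card {i \<in> J. u i < u j}} = card J - k"
proof -
  let ?B = "{j \<in> J. k \<le> card {i \<in> J. u i < u j}}"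
  let ?C = "{j \<in> J. card {i \<in> J. u i < u j} < k}"
  have "card ?C \<le> k"
  proof (cases "?C = {}")
    case False
    have finC: "finite ?C" using assms by simp
    define j where "j = arg_min_on (\<lambda>j. - u j) ?C"
    have j: "j \<in> ?C" unfolding j_def using arg_min_if_finite(1)[OF finC False] .
    have le: "u i \<le> u j" if "i \<in> ?C" for i
      using arg_min_least[OF finC False that, of "\<lambda>j. - u j"] unfolding j_def by simp
    have "?C \<subseteq> insert j {i \<in> J. u i < u j}"
    proof
      fix i assume i: "i \<in> ?C"
      then have "u i = u j \<Longrightarrow> i = j" using assms(2) j by (auto dest: inj_onD)
      then show "i \<in> insert j {i \<in> J. u i < u j}" using le[OF i] i by auto
    qed
    then have "card ?C \<le> card (insert j {i \<in> J. u i < u j})"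
      by (rule card_mono[rotated]) (use assms in auto)
    also have "\<dots> \<le> Suc (card {i \<in> J. u i < u j})"
      using assms(1) by (simp add: card_insert_if)
    finally have 1: "card ?C \<le> Suc (card {i \<in> J. u i < u j})" .
    have "card {i \<in> J. u i < u j} < k" using j by simp
    with 1 show ?thesis by linarith
  qed (simp only: card.empty)
  moreover have "card J = card ?B + card ?C"
  proof -
    have "J = ?B \<union> ?C" by auto
    then have "card J = card (?B \<union> ?C)" by simp
    also have "\<dots> = card ?B + card ?C"
      by (rule card_Un_disjoint) (use assms in auto)
    finally show ?thesis .
  qed
  ultimately show ?thesis using card_ranks_ge_le[OF assms(1), of k u] by linarith
qed

section \<open>Sets of tuples symmetric in positions and values\<close>

text \<open>Covers both sampling schemes at once. Swapping positions makes all positions equally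
  likely to have a large rank; permuting the values in \<open>H\<close> moves the base point.
  \<open>restrict\<close> keeps the relabelled tuple extensional, as membership in
  \<open>J \<rightarrow>\<^sub>E H\<close> demands.\<close>

definition symmetric_tuples :: "'j set \<Rightarrow> 'a set \<Rightarrow> ('j \<Rightarrow> 'a) set \<Rightarrow> bool" where
  "symmetric_tuples J H U \<longleftrightarrow> U \<subseteq> J \<rightarrow>\<^sub>E H \<and>
     (\<forall>s\<in>U. \<forall>i\<in>J. \<forall>j\<in>J. s \<circ> Transposition.transpose i j \<in> U) \<and>
     (\<forall>s\<in>U. \<forall>p. bij_betw p H H \<longrightarrow> restrict (p \<circ> s) J \<in> U)"

lemma symmetric_tuples_PiE: "symmetric_tuples J H (J \<rightarrow>\<^sub>E H)"
  unfolding symmetric_tuples_def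
proof (intro conjI ballI allI impI)
  fix s i j assume "s \<in> J \<rightarrow>\<^sub>E H" "i \<in> J" "j \<in> J"
  then show "s \<circ> Transposition.transpose i j \<in> J \<rightarrow>\<^sub>E H"
    by (auto simp: PiE_iff Transposition.transpose_def extensional_def)
next
  fix s p assume "s \<in> J \<rightarrow>\<^sub>E H" "bij_betw p H H"
  then show "restrict (p \<circ> s) J \<in> J \<rightarrow>\<^sub>E H"
    by (auto simp: PiE_iff bij_betw_def)
qed simp

lemma symmetric_tuples_injective: "symmetric_tuples J H (injective_tuples J H)"
  unfolding symmetric_tuples_def
proof (intro conjI ballI allI impI)
  fix s i j assume s: "s \<in> injective_tuples J H" "i \<in> J" "j \<in> J"
  then have "s \<circ> Transposition.transpose i j \<in> J \<rightarrow>\<^sub>E H"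
    using symmetric_tuples_PiE[of J H] by (auto simp: symmetric_tuples_def injective_tuples_def)
  moreover have "inj_on (s \<circ> Transposition.transpose i j) J"
  proof (rule comp_inj_on)
    show "inj_on (Transposition.transpose i j) J" by simp
    have "Transposition.transpose i j ` J = J" using s by (simp add: transpose_image_eq)
    then show "inj_on s (Transposition.transpose i j ` J)" using s by (simp add: injective_tuples_def)
  qed
  ultimately show "s \<circ> Transposition.transpose i j \<in> injective_tuples J H" by (simp add: injective_tuples_def)
next
  fix s p assume s: "s \<in> injective_tuples J H" and p: "bij_betw p H H"
  then have "restrict (p \<circ> s) J \<in> J \<rightarrow>\<^sub>E H"
    using symmetric_tuples_PiE[of J H] by (auto simp: symmetric_tuples_def injective_tuples_def)
  moreover have "inj_on (p \<circ> s) J"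
    using s p by (intro comp_inj_on)
      (auto simp: injective_tuples_def bij_betw_def intro: inj_on_subset)
  ultimately show "restrict (p \<circ> s) J \<in> injective_tuples J H"
    by (simp add: injective_tuples_def)
qed (auto simp: injective_tuples_def)

text \<open>The threshold \<open>v (s j)\<close> is the value at position \<open>i\<close> after the
  swap. So position \<open>i\<close> of the swapped tuple inherits the rank of position
  \<open>j\<close> of \<open>s\<close>; the transposition itself matches the two sets.\<close>

lemma card_below_transpose:
  fixes v :: "'a \<Rightarrow> real"
  assumes "finite J" "i \<in> J" "j \<in> J"
  shows "card {l \<in> J. v ((s \<circ> Transposition.transpose i j) l) < v (s j)} = card {l \<in> J. v (s l) < v (s j)}"
proof -
  have "bij_betw (Transposition.transpose i j) {l \<in> J. v ((s \<circ> Transposition.transpose i j) l) < v (s j)}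
          {l \<in> J. v (s l) < v (s j)}"
    by (rule bij_betwI[where g = "Transposition.transpose i j"]) (use assms in \<open>auto simp: Transposition.transpose_def\<close>)
  then show ?thesis by (rule bij_betw_same_card)
qed

text \<open>Exchanging the position \<open>i\<close> with every other position turns the count over tuples into a
  count over positions of one fixed tuple.\<close>

lemma card_tuples_rank_ge:
  fixes v :: "'a \<Rightarrow> real"
  assumes J: "finite J" "i \<in> J" and H: "finite H" and U: "symmetric_tuples J H U"
  shows "card {s \<in> U. k \<le> card {l \<in> J. v (s l) < v (s i)}} * card J
           = (\<Sum>s\<in>U. card {j \<in> J. k \<le> card {l \<in> J. v (s l) < v (s j)}})"
proof -
  have finU: "finite U"
    using U J H by (auto simp: symmetric_tuples_def intro: finite_subset finite_PiE)
  let ?P = "\<lambda>s j. k \<le> card {l \<in> J. v (s l) < v (s j)}"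
  have eq: "card {s \<in> U. ?P s j} = card {s \<in> U. ?P s i}" if j: "j \<in> J" for j
  proof -
    have "bij_betw (\<lambda>s. s \<circ> Transposition.transpose i j) {s \<in> U. ?P s j} {s \<in> U. ?P s i}"
    proof (rule bij_betwI[where g = "\<lambda>s. s \<circ> Transposition.transpose i j"])
      have *: "s \<circ> Transposition.transpose i j \<in> U" if "s \<in> U" for s
        using that U J j by (auto simp: symmetric_tuples_def)
      show "(\<lambda>s. s \<circ> Transposition.transpose i j) \<in> {s \<in> U. ?P s j} \<rightarrow> {s \<in> U. ?P s i}"
        using * card_below_transpose[OF J j, of v] by (auto simp: o_def)
      show "(\<lambda>s. s \<circ> Transposition.transpose i j) \<in> {s \<in> U. ?P s i} \<rightarrow> {s \<in> U. ?P s j}"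
        using * card_below_transpose[OF J(1) j J(2), of v]
        by (auto simp: o_def transpose_commute[of i j])
    qed (auto simp: fun_eq_iff)
    then show ?thesis by (rule bij_betw_same_card)
  qed
  \<comment> \<open>Double counting of the pairs of a tuple \<open>s\<close> and a position
    \<open>j\<close> with \<open>?P s j\<close>; by \<open>eq\<close> every position occurs in
    equally many of them.\<close>
  have "card {s \<in> U. ?P s i} * card J = (\<Sum>j\<in>J. card {s \<in> U. ?P s j})"
    using eq by simp
  also have "\<dots> = (\<Sum>j\<in>J. \<Sum>s\<in>U. if ?P s j then 1 else 0)"
    using finU by (simp add: sum.If_cases Int_def)
  also have "\<dots> = (\<Sum>s\<in>U. \<Sum>j\<in>J. if ?P s j then 1 else 0)"
    by (rule sum.swap)
  also have "\<dots> = (\<Sum>s\<in>U. card {j \<in> J. ?P s j})"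
    using J by (simp add: sum.If_cases Int_def)
  finally show ?thesis .
qed

section \<open>Order statistics and the rejection condition\<close>

text \<open>In the sorted list the entries below \<open>x\<close> form an initial segment, and the
  entry number \<open>k\<close>, at list position \<open>k - 1\<close>, belongs to it exactly when
  the segment has at least \<open>k\<close> elements.\<close>

lemma order_statistic_less_iff:
  assumes "1 \<le> k" "k \<le> length xs"
  shows "order_statistic xs k < x \<longleftrightarrow> k \<le> length (filter (\<lambda>y. y < x) xs)"
proof -
  define ys where "ys = sort xs"
  have ys: "sorted ys" "length ys = length xs" by (simp_all add: ys_def)
  have "length (filter (\<lambda>y. y < x) xs) = length (filter (\<lambda>y. y < x) ys)"
    by (simp add: ys_def filter_sort)
  also have "\<dots> = card {i. i < length ys \<and> ys ! i < x}"
    by (rule length_filter_conv_card)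
  finally have len: "length (filter (\<lambda>y. y < x) xs) = card {i. i < length ys \<and> ys ! i < x}" .
  show ?thesis
  proof
    assume "order_statistic xs k < x"
    then have less: "ys ! (k - 1) < x" by (simp add: order_statistic_def ys_def)
    have "ys ! i < x" if "i < k" for i
    proof -
      have "ys ! i \<le> ys ! (k - 1)"
        by (rule sorted_nth_mono[OF ys(1)]) (use that assms ys in auto)
      then show ?thesis using less by simp
    qed
    then have "{..<k} \<subseteq> {i. i < length ys \<and> ys ! i < x}" using assms ys by auto
    then have "card {..<k} \<le> card {i. i < length ys \<and> ys ! i < x}" by (rule card_mono[rotated]) simp
    then show "k \<le> length (filter (\<lambda>y. y < x) xs)" by (simp add: len)
  next
    assume le: "k \<le> length (filter (\<lambda>y. y < x) xs)"
    show "order_statistic xs k < x"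
    proof (rule ccontr)
      assume "\<not> order_statistic xs k < x"
      then have "i < k - 1" if "i < length ys" "ys ! i < x" for i
        using sorted_nth_mono[OF ys(1), of "k - 1" i] that
        by (force simp: order_statistic_def ys_def[symmetric] not_less)
      then have "{i. i < length ys \<and> ys ! i < x} \<subseteq> {..<k - 1}" by auto
      then have "card {i. i < length ys \<and> ys ! i < x} \<le> card {..<k - 1}"
        by (rule card_mono[rotated]) simp
      then show False using le assms by (simp add: len)
    qed
  qed
qed

text \<open>Turns the test into a rank condition: once \<open>f 1\<close> fixes \<open>x\<close>,
  rejection means that position 1 has at least k' of the values strictly below its own.\<close>

lemma rejects_iff:
  assumes "\<alpha> \<in> {0..<1}" "w \<ge> 1"
  shows "rejects T \<alpha> (map f [1..<Suc w]) x \<longleftrightarrow>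
           nat \<lceil>(1 - \<alpha>) * real w\<rceil> \<le> card {j \<in> {1..w}. T (f j x) < T x}"
proof -
  define k where "k = nat \<lceil>(1 - \<alpha>) * real w\<rceil>"
  \<comment> \<open>\<open>\<alpha> < 1\<close> gives \<open>1 \<le> k\<close> and
    \<open>0 \<le> \<alpha>\<close> gives \<open>k \<le> w\<close>, so the order statistic is a
    genuine entry of the list.\<close>
  have "0 < (1 - \<alpha>) * real w" using assms by simp
  moreover have "(1 - \<alpha>) * real w \<le> real w" using assms by (simp add: algebra_simps)
  ultimately have k: "1 \<le> k" "k \<le> w" unfolding k_def by linarith+
  have "rejects T \<alpha> (map f [1..<Suc w]) x \<longleftrightarrow>
      k \<le> length (filter (\<lambda>y. y < T x) (map (\<lambda>a. T (a x)) (map f [1..<Suc w])))"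
    unfolding rejects_def
    by (subst order_statistic_less_iff[symmetric]) (use k in \<open>auto simp: k_def simp del: upt_Suc\<close>)
  also have "length (filter (\<lambda>y. y < T x) (map (\<lambda>a. T (a x)) (map f [1..<Suc w])))
      = length (filter (\<lambda>j. T (f j x) < T x) [1..<Suc w])"
    by (simp add: filter_map o_def del: upt_Suc)
  also have "\<dots> = card {j \<in> {1..w}. T (f j x) < T x}"
    by (subst distinct_length_filter) (auto intro!: arg_cong[where f = card] simp del: upt_Suc)
  finally show ?thesis by (simp add: k_def)
qed

section \<open>Measurability of counts, and conditioning on a uniform draw\<close>

text \<open>A lower bound on the count is a finite disjunction, over the subsets \<open>A\<close> of
  \<open>J\<close> with at least \<open>k\<close> elements, of finite conjunctions of the
  \<open>P j\<close>.\<close>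

lemma pred_le_card:
  assumes "finite J" "\<And>j. j \<in> J \<Longrightarrow> Measurable.pred N (P j)"
  shows "Measurable.pred N (\<lambda>x. k \<le> card {j \<in> J. P j x})"
proof -
  have "k \<le> card {j \<in> J. P j x} \<longleftrightarrow> (\<exists>A\<in>{A \<in> Pow J. k \<le> card A}. \<forall>j\<in>A. P j x)" for x
  proof
    assume "k \<le> card {j \<in> J. P j x}"
    then show "\<exists>A\<in>{A \<in> Pow J. k \<le> card A}. \<forall>j\<in>A. P j x"
      by (intro bexI[of _ "{j \<in> J. P j x}"]) auto
  next
    assume "\<exists>A\<in>{A \<in> Pow J. k \<le> card A}. \<forall>j\<in>A. P j x"
    then obtain A where A: "A \<subseteq> J" "k \<le> card A" "\<forall>j\<in>A. P j x" by auto
    then have "card A \<le> card {j \<in> J. P j x}" using assms(1) by (intro card_mono) auto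
    with A show "k \<le> card {j \<in> J. P j x}" by simp
  qed
  moreover have "Measurable.pred N (\<lambda>x. \<exists>A\<in>{A \<in> Pow J. k \<le> card A}. \<forall>j\<in>A. P j x)"
    using assms by (intro pred_intros_finite) (auto intro: finite_subset)
  ultimately show ?thesis by simp
qed

text \<open>The event splits according to the finitely many values of \<open>Y\<close>, and
  independence factors each piece. This replaces the random transformations by an average over fixed
  tuples.\<close>

lemma (in prob_space) prob_independent_uniform_draw:
  assumes indep: "indep_random_elements M S X B Y"
    and D: "finite D" "\<And>\<omega>. \<omega> \<in> space M \<Longrightarrow> Y \<omega> \<in> D" "\<And>t. t \<in> D \<Longrightarrow> {t} \<in> sets B"
    and unif: "\<And>t. t \<in> D \<Longrightarrow> prob {\<omega> \<in> space M. Y \<omega> = t} = 1 / card D"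
    and E: "\<And>t. t \<in> D \<Longrightarrow> E t \<in> sets S"
  shows "prob {\<omega> \<in> space M. X \<omega> \<in> E (Y \<omega>)} = (\<Sum>t\<in>D. prob {\<omega> \<in> space M. X \<omega> \<in> E t}) / card D"
proof -
  have X: "X \<in> measurable M S" and Y: "Y \<in> measurable M B"
    and I: "indep_set {X -` E \<inter> space M | E. E \<in> sets S} {Y -` E \<inter> space M | E. E \<in> sets B}"
    using indep by (auto simp: indep_random_elements_def)
  define F where "F t = {\<omega> \<in> space M. X \<omega> \<in> E t} \<inter> {\<omega> \<in> space M. Y \<omega> = t}" for t
  have eqX: "{\<omega> \<in> space M. X \<omega> \<in> E t} = X -` E t \<inter> space M" for t by auto
  have eqY: "{\<omega> \<in> space M. Y \<omega> = t} = Y -` {t} \<inter> space M" for t by auto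
  have F: "F t \<in> events" if "t \<in> D" for t
    unfolding F_def eqX eqY using measurable_sets[OF X E[OF that]] measurable_sets[OF Y D(3)[OF that]] by auto
  have "{\<omega> \<in> space M. X \<omega> \<in> E (Y \<omega>)} = (\<Union>t\<in>D. F t)"
    using D(2) by (auto simp: F_def)
  then have "prob {\<omega> \<in> space M. X \<omega> \<in> E (Y \<omega>)} = (\<Sum>t\<in>D. prob (F t))"
    using F D(1) by (simp, intro finite_measure_finite_Union) (auto simp: disjoint_family_on_def F_def)
  also have "\<dots> = (\<Sum>t\<in>D. prob {\<omega> \<in> space M. X \<omega> \<in> E t} / card D)"
  proof (rule sum.cong[OF refl])
    fix t assume t: "t \<in> D"
    have "prob (F t) = prob {\<omega> \<in> space M. X \<omega> \<in> E t} * prob {\<omega> \<in> space M. Y \<omega> = t}"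
      unfolding F_def by (rule indep_setD[OF I]) (use E D(3) t eqX eqY in blast)+
    then show "prob (F t) = prob {\<omega> \<in> space M. X \<omega> \<in> E t} / card D"
      by (simp add: unif[OF t])
  qed
  finally show ?thesis by (simp add: sum_divide_distrib)
qed

section \<open>Consequences of the null hypothesis and the tie pattern\<close>

text \<open>\<open>R\<close> is the relation of lying in the same class of the partition; as a
  relation it can be compared with its image under right multiplication without reference to an
  indexing of the classes.\<close>

locale tied_invariant_statistic = prob_space M for M :: "'w measure" +
  fixes S :: "'x measure" and X :: "'w \<Rightarrow> 'x" and G :: "('x \<Rightarrow> 'x) set" and T :: "'x \<Rightarrow> real"
    and R :: "('x \<Rightarrow> 'x) rel"
  assumes X [measurable]: "X \<in> measurable M S"
    and finite_G: "finite G"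
    and subgroup_G: "subgroup G (BijGroup (space S))"
    and measurable_G: "\<And>a. a \<in> G \<Longrightarrow> a \<in> measurable S S"
    and T [measurable]: "T \<in> borel_measurable S"
    and null: "null_hypothesis M X G T"
    and equiv_R: "equiv G R"
    and ties: "AE \<omega> in M. \<forall>a\<in>G. \<forall>b\<in>G. T (a (X \<omega>)) = T (b (X \<omega>)) \<longleftrightarrow> (a, b) \<in> R"
begin

abbreviation prod_G (infixl "\<odot>" 70) where "a \<odot> b \<equiv> a \<otimes>\<^bsub>BijGroup (space S)\<^esub> b"

lemma prod_G_closed: "a \<in> G \<Longrightarrow> b \<in> G \<Longrightarrow> a \<odot> b \<in> G"
  using subgroup_G by (rule subgroup.m_closed)

text \<open>Multiplication in \<open>BijGroup\<close> is composition cut off outside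
  \<open>space S\<close>, hence the restriction to points of the sample space.\<close>

lemma prod_G_apply:
  assumes "a \<in> G" "b \<in> G" "x \<in> space S"
  shows "(a \<odot> b) x = a (b x)"
proof -
  have "a \<in> Bij (space S)" "b \<in> Bij (space S)"
    using assms subgroup.subset[OF subgroup_G] by (auto simp: BijGroup_def)
  with assms(3) show ?thesis by (simp add: BijGroup_def compose_def)
qed

lemma measurable_T_G [measurable]: "a \<in> G \<Longrightarrow> (\<lambda>\<omega>. T (a (X \<omega>))) \<in> borel_measurable M"
  using measurable_compose[OF measurable_compose[OF X measurable_G] T] .

lemma measurable_T_G_G:
  assumes "a \<in> G" "b \<in> G"
  shows "(\<lambda>\<omega>. T (a (b (X \<omega>)))) \<in> borel_measurable M"
  using measurable_compose[OF measurable_compose[OF measurable_compose[OF X measurable_G] measurable_G] T,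
      OF assms(2,1)] .

text \<open>The form in which the null hypothesis is applied below: for tie patterns in
  \<open>right_invariant\<close> and for rank conditions in
  \<open>prob_rank_event_translate\<close>.\<close>

lemma prob_null_hypothesis:
  assumes "g \<in> G" and A: "Measurable.pred (\<Pi>\<^sub>M a\<in>G. borel) P"
  shows "prob {\<omega> \<in> space M. P (\<lambda>a\<in>G. T (a (X \<omega>)))}
       = prob {\<omega> \<in> space M. P (\<lambda>a\<in>G. T (a (g (X \<omega>))))}"
proof -
  let ?N = "\<Pi>\<^sub>M a\<in>G. borel :: real measure"
  let ?A = "{v \<in> space ?N. P v}"
  have A': "?A \<in> sets ?N" using A by simp
  have 1: "(\<lambda>\<omega>. \<lambda>a\<in>G. T (a (X \<omega>))) \<in> measurable M ?N"
    by (intro measurable_restrict measurable_T_G)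
  have 2: "(\<lambda>\<omega>. \<lambda>a\<in>G. T (a (g (X \<omega>)))) \<in> measurable M ?N"
    by (intro measurable_restrict measurable_T_G_G assms)
  have "measure (distr M ?N (\<lambda>\<omega>. \<lambda>a\<in>G. T (a (X \<omega>)))) ?A
      = measure (distr M ?N (\<lambda>\<omega>. \<lambda>a\<in>G. T (a (g (X \<omega>))))) ?A"
    using null assms(1) by (simp add: null_hypothesis_def)
  moreover have "(\<lambda>\<omega>. \<lambda>a\<in>G. T (a (X \<omega>))) -` ?A \<inter> space M
      = {\<omega> \<in> space M. P (\<lambda>a\<in>G. T (a (X \<omega>)))}" by (auto simp: space_PiM)
  moreover have "(\<lambda>\<omega>. \<lambda>a\<in>G. T (a (g (X \<omega>)))) -` ?A \<inter> space M
      = {\<omega> \<in> space M. P (\<lambda>a\<in>G. T (a (g (X \<omega>))))}" by (auto simp: space_PiM)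
  ultimately show ?thesis by (simp add: measure_distr[OF 1 A'] measure_distr[OF 2 A'])
qed

text \<open>By the null hypothesis the tie pattern of \<open>T (a (g X))\<close> is almost surely the same as that of
  \<open>T (a X)\<close>, so the classes of \<open>R\<close> are the right cosets of a subgroup.\<close>

lemma right_invariant:
  assumes g: "g \<in> G" and ab: "a \<in> G" "b \<in> G"
  shows "(a \<odot> g, b \<odot> g) \<in> R \<longleftrightarrow> (a, b) \<in> R"
proof -
  \<comment> \<open>Equality of the two coordinates is written as two inequalities, whose
    measurability comes from \<open>borel_measurable_le\<close>.\<close>
  let ?P = "\<lambda>v :: ('x \<Rightarrow> 'x) \<Rightarrow> real. (v a \<le> v b \<and> v b \<le> v a) \<longleftrightarrow> (a, b) \<in> R"
  have [measurable]: "(\<lambda>v. v a) \<in> borel_measurable (\<Pi>\<^sub>M a\<in>G. (borel :: real measure))"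
    "(\<lambda>v. v b) \<in> borel_measurable (\<Pi>\<^sub>M a\<in>G. (borel :: real measure))"
    using ab by simp_all
  have P: "Measurable.pred (\<Pi>\<^sub>M a\<in>G. (borel :: real measure)) ?P"
  proof -
    have "{v \<in> space (\<Pi>\<^sub>M a\<in>G. (borel :: real measure)). v a \<le> v b} \<in> sets (\<Pi>\<^sub>M a\<in>G. (borel :: real measure))"
      "{v \<in> space (\<Pi>\<^sub>M a\<in>G. (borel :: real measure)). v b \<le> v a} \<in> sets (\<Pi>\<^sub>M a\<in>G. (borel :: real measure))"
      by (intro borel_measurable_le; fact)+
    then show ?thesis by (intro pred_intros_logic) (simp_all add: pred_def)
  qed
  have "AE \<omega> in M. ?P (\<lambda>a\<in>G. T (a (X \<omega>)))"
    using ties by eventually_elim (use ab in \<open>simp flip: order_eq_iff\<close>)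
  then have "prob {\<omega> \<in> space M. ?P (\<lambda>a\<in>G. T (a (X \<omega>)))} = 1"
    using ab measurable_T_G by (subst prob_Collect_eq_1) auto
  then have "prob {\<omega> \<in> space M. ?P (\<lambda>a\<in>G. T (a (g (X \<omega>))))} = 1"
    by (simp only: prob_null_hypothesis[OF g P])
  from AE_prob_1[OF this] have "AE \<omega> in M. ?P (\<lambda>a\<in>G. T (a (g (X \<omega>))))"
    by eventually_elim blast
  then have "AE \<omega> in M. (a \<odot> g, b \<odot> g) \<in> R \<longleftrightarrow> (a, b) \<in> R"
    using ties AE_space
  proof eventually_elim
    case (elim \<omega>)
    have "X \<omega> \<in> space S" using measurable_space[OF X] elim by auto
    moreover have "T ((a \<odot> g) (X \<omega>)) = T ((b \<odot> g) (X \<omega>)) \<longleftrightarrow> (a \<odot> g, b \<odot> g) \<in> R"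
      using elim ab g prod_G_closed by blast
    ultimately show ?case using elim ab g by (simp add: prod_G_apply flip: order_eq_iff)
  qed
  \<comment> \<open>The equivalence does not depend on the outcome, so holding almost surely on a
    probability space makes it true.\<close>
  then show ?thesis by (simp add: AE_const)
qed

section \<open>Rank events and their invariance\<close>

text \<open>A set of sample points rather than of outcomes: for each fixed tuple \<open>s\<close> it
  is an event for \<open>X\<close>, as \<open>prob_independent_uniform_draw\<close> requires.
  Position \<open>i\<close> is the base point.\<close>

definition rank_event :: "'j set \<Rightarrow> nat \<Rightarrow> 'j \<Rightarrow> ('j \<Rightarrow> 'x \<Rightarrow> 'x) \<Rightarrow> 'x set" where
  "rank_event J k i s = {x \<in> space S. k \<le> card {j \<in> J. T (s j x) < T (s i x)}}"

lemma sets_rank_event: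
  assumes "finite J" "i \<in> J" "\<And>j. j \<in> J \<Longrightarrow> s j \<in> G"
  shows "rank_event J k i s \<in> sets S"
proof -
  have [measurable]: "(\<lambda>x. T (s j x)) \<in> borel_measurable S" if "j \<in> J" for j
    using measurable_compose[OF measurable_G T] assms that by blast
  have "Measurable.pred S (\<lambda>x. k \<le> card {j \<in> J. T (s j x) < T (s i x)})"
    using assms by (intro pred_le_card) measurable
  then show ?thesis by (simp add: rank_event_def pred_def)
qed

lemma X_in_rank_event:
  "\<omega> \<in> space M \<Longrightarrow> X \<omega> \<in> rank_event J k i s \<longleftrightarrow>
     k \<le> card {j \<in> J. T (s j (X \<omega>)) < T (s i (X \<omega>))}"
  using measurable_space[OF X] by (auto simp: rank_event_def)

lemma events_rank_event:
  assumes "finite J" "i \<in> J" "\<And>j. j \<in> J \<Longrightarrow> s j \<in> G"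
  shows "{\<omega> \<in> space M. X \<omega> \<in> rank_event J k i s} \<in> events"
proof -
  have "{\<omega> \<in> space M. X \<omega> \<in> rank_event J k i s} = X -` rank_event J k i s \<inter> space M" by auto
  then show ?thesis using measurable_sets[OF X sets_rank_event[OF assms]] by simp
qed

text \<open>Almost surely the statistic is constant on classes, so exchanging transformations within
  their classes changes the event by a null set only.\<close>

lemma prob_rank_event_cong:
  assumes "finite J" "i \<in> J" "\<And>j. j \<in> J \<Longrightarrow> (s j, s' j) \<in> R"
  shows "prob {\<omega> \<in> space M. X \<omega> \<in> rank_event J k i s}
       = prob {\<omega> \<in> space M. X \<omega> \<in> rank_event J k i s'}"
proof (rule finite_measure_eq_AE)
  have R_G: "R \<subseteq> G \<times> G" using equiv_R by (simp add: equiv_def refl_on_def)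
  then have G: "s j \<in> G" "s' j \<in> G" if "j \<in> J" for j
    using assms(3)[OF that] by auto
  show "{\<omega> \<in> space M. X \<omega> \<in> rank_event J k i s} \<in> events"
    "{\<omega> \<in> space M. X \<omega> \<in> rank_event J k i s'} \<in> events"
    using G assms by (auto intro!: events_rank_event)
  show "AE \<omega> in M. \<omega> \<in> {\<omega> \<in> space M. X \<omega> \<in> rank_event J k i s} \<longleftrightarrow>
          \<omega> \<in> {\<omega> \<in> space M. X \<omega> \<in> rank_event J k i s'}"
    using ties AE_space
  proof eventually_elim
    case (elim \<omega>)
    then have "T (s j (X \<omega>)) = T (s' j (X \<omega>))" if "j \<in> J" for j
      using G assms(3) that by blast
    then have "{j \<in> J. T (s j (X \<omega>)) < T (s i (X \<omega>))} = {j \<in> J. T (s' j (X \<omega>)) < T (s' i (X \<omega>))}"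
      using assms(2) by auto
    then show ?case using elim by (simp add: X_in_rank_event)
  qed
qed

text \<open>The event depends on \<open>X\<close> only through the vector of all
  \<open>T (a X)\<close>. Multiplying every entry of the tuple by \<open>g\<close> on the right
  turns this vector into that of \<open>T (a (g X))\<close>, which has the same law.\<close>

lemma prob_rank_event_translate:
  assumes J: "finite J" "i \<in> J" and s: "\<And>j. j \<in> J \<Longrightarrow> s j \<in> G" and g: "g \<in> G"
  shows "prob {\<omega> \<in> space M. X \<omega> \<in> rank_event J k i (\<lambda>j. s j \<odot> g)}
       = prob {\<omega> \<in> space M. X \<omega> \<in> rank_event J k i s}"
proof -
  let ?P = "\<lambda>v :: ('x \<Rightarrow> 'x) \<Rightarrow> real. k \<le> card {j \<in> J. v (s j) < v (s i)}"
  have "(\<lambda>v. v (s j)) \<in> borel_measurable (\<Pi>\<^sub>M a\<in>G. (borel :: real measure))" if "j \<in> J" for j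
    using s[OF that] by simp
  then have P: "Measurable.pred (\<Pi>\<^sub>M a\<in>G. (borel :: real measure)) ?P"
    using J by (intro pred_le_card borel_measurable_pred_less) auto
  have "{\<omega> \<in> space M. X \<omega> \<in> rank_event J k i s} = {\<omega> \<in> space M. ?P (\<lambda>a\<in>G. T (a (X \<omega>)))}"
  proof -
    have "{j \<in> J. T (s j (X \<omega>)) < T (s i (X \<omega>))} =
        {j \<in> J. (\<lambda>a\<in>G. T (a (X \<omega>))) (s j) < (\<lambda>a\<in>G. T (a (X \<omega>))) (s i)}" for \<omega>
      using s J(2) by auto
    then show ?thesis by (auto simp only: X_in_rank_event cong: conj_cong)
  qed
  moreover have "{\<omega> \<in> space M. X \<omega> \<in> rank_event J k i (\<lambda>j. s j \<odot> g)} =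
      {\<omega> \<in> space M. ?P (\<lambda>a\<in>G. T (a (g (X \<omega>))))}"
  proof -
    have "{j \<in> J. T ((s j \<odot> g) (X \<omega>)) < T ((s i \<odot> g) (X \<omega>))} =
        {j \<in> J. (\<lambda>a\<in>G. T (a (g (X \<omega>)))) (s j) < (\<lambda>a\<in>G. T (a (g (X \<omega>)))) (s i)}"
      if "\<omega> \<in> space M" for \<omega>
      using s J(2) g measurable_space[OF X that] by (auto simp: prod_G_apply)
    then show ?thesis by (auto simp only: X_in_rank_event cong: conj_cong)
  qed
  ultimately show ?thesis using prob_null_hypothesis[OF g P] by simp
qed

section \<open>Moving and averaging the base point\<close>

text \<open>The element \<open>g\<close> is the inverse of \<open>a\<close> times \<open>b\<close>,
  and \<open>p c\<close> is the representative of the class of \<open>c \<odot> g\<close>. Right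
  invariance makes \<open>p\<close> injective, hence a permutation of the finite set
  \<open>H\<close>.\<close>

lemma transversal_translate:
  assumes H: "H \<subseteq> G" "\<And>a. a \<in> G \<Longrightarrow> \<exists>!b. b \<in> H \<and> (a, b) \<in> R" and ab: "a \<in> H" "b \<in> H"
  obtains p g where "bij_betw p H H" "p a = b" "g \<in> G" "\<And>c. c \<in> H \<Longrightarrow> (p c, c \<odot> g) \<in> R"
proof -
  interpret B: group "BijGroup (space S)" by (rule group_BijGroup)
  have GB: "G \<subseteq> carrier (BijGroup (space S))" using subgroup.subset[OF subgroup_G] .
  define g where "g = inv\<^bsub>BijGroup (space S)\<^esub> a \<odot> b"
  have aG: "a \<in> G" "b \<in> G" using ab H by auto
  have g: "g \<in> G"
    unfolding g_def using aG subgroup.m_inv_closed[OF subgroup_G] by (intro prod_G_closed) auto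
  have ag: "a \<odot> g = b"
    unfolding g_def using aG GB by (simp add: B.m_assoc[symmetric] subset_iff)
  define p where "p c = (THE d. d \<in> H \<and> (c \<odot> g, d) \<in> R)" for c
  have p: "p c \<in> H" "(c \<odot> g, p c) \<in> R" if "c \<in> H" for c
    using theI'[OF H(2)[OF prod_G_closed[OF subsetD[OF H(1) that] g]]] unfolding p_def by auto
  have sym: "(y, x) \<in> R" if "(x, y) \<in> R" for x y
    using equiv_R that by (auto simp: equiv_def dest: symD)
  have trans: "(x, z) \<in> R" if "(x, y) \<in> R" "(y, z) \<in> R" for x y z
    using equiv_R that by (auto simp: equiv_def dest: transD)
  have refl_R: "(x, x) \<in> R" if "x \<in> G" for x
    using equiv_R that by (auto simp: equiv_def dest: refl_onD)
  have "inj_on p H"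
  proof (rule inj_onI)
    fix c d assume cd: "c \<in> H" "d \<in> H" "p c = p d"
    \<comment> \<open>Both products are related to the common representative
      \<open>p c = p d\<close>; \<open>right_invariant\<close> then cancels
      \<open>g\<close>.\<close>
    then have "(c \<odot> g, d \<odot> g) \<in> R" using p[of c] p[of d] sym trans by metis
    then have "(c, d) \<in> R" using right_invariant[OF g, of c d] cd H by auto
    then show "c = d" using H(2)[of c] refl_R cd H(1) by blast
  qed
  moreover have "p ` H \<subseteq> H" using p by auto
  ultimately have "bij_betw p H H"
    using finite_subset[OF H(1) finite_G] by (simp add: bij_betw_def endo_inj_surj)
  moreover have "p a = b"
    using p[OF ab(1)] H(2)[of b] refl_R[of b] aG ab by (auto simp: ag)
  ultimately show thesis using that g p sym by blast
qed

text \<open>Relabelling every entry by the permutation \<open>p\<close> with \<open>p a = b\<close>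
  matches the tuples with base value \<open>a\<close> to those with base value \<open>b\<close> and
  preserves each probability.\<close>

lemma sum_prob_rank_event_base:
  assumes H: "H \<subseteq> G" "\<And>a. a \<in> G \<Longrightarrow> \<exists>!b. b \<in> H \<and> (a, b) \<in> R"
    and J: "finite J" "i \<in> J" and U: "symmetric_tuples J H U" and ab: "a \<in> H" "b \<in> H"
  shows "(\<Sum>s | s \<in> U \<and> s i = a. prob {\<omega> \<in> space M. X \<omega> \<in> rank_event J k i s})
       = (\<Sum>s | s \<in> U \<and> s i = b. prob {\<omega> \<in> space M. X \<omega> \<in> rank_event J k i s})"
    and "card {s \<in> U. s i = a} = card {s \<in> U. s i = b}"
proof -
  obtain p g where p: "bij_betw p H H" "p a = b" "g \<in> G" "\<And>c. c \<in> H \<Longrightarrow> (p c, c \<odot> g) \<in> R"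
    using transversal_translate[OF H ab] by blast
  let ?q = "inv_into H p"
  have q: "bij_betw ?q H H" using p(1) by (rule bij_betw_inv_into)
  have qp: "?q (p c) = c" if "c \<in> H" for c
    using p(1) that by (simp add: bij_betw_def inv_into_f_f)
  have pq: "p (?q c) = c" if "c \<in> H" for c
    using p(1) that by (simp add: bij_betw_def f_inv_into_f)
  have sH: "s j \<in> H" if "s \<in> U" "j \<in> J" for s j
    using U that by (auto simp: symmetric_tuples_def)
  have ext: "s \<in> extensional J" if "s \<in> U" for s
    using U that by (auto simp: symmetric_tuples_def PiE_iff)
  have bij: "bij_betw (\<lambda>s. restrict (p \<circ> s) J) {s \<in> U. s i = a} {s \<in> U. s i = b}"
  proof (rule bij_betwI[where g = "\<lambda>s. restrict (?q \<circ> s) J"])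
    show "(\<lambda>s. restrict (p \<circ> s) J) \<in> {s \<in> U. s i = a} \<rightarrow> {s \<in> U. s i = b}"
      using U p J(2) by (auto simp: symmetric_tuples_def)
    have "?q b = a" using qp[OF ab(1)] p(2) by simp
    then show "(\<lambda>s. restrict (?q \<circ> s) J) \<in> {s \<in> U. s i = b} \<rightarrow> {s \<in> U. s i = a}"
      using U q J(2) by (auto simp: symmetric_tuples_def)
    show "restrict (?q \<circ> restrict (p \<circ> s) J) J = s" if "s \<in> {s \<in> U. s i = a}" for s
      using that ext[of s] sH[of s] qp by (auto simp: fun_eq_iff extensional_def)
    show "restrict (p \<circ> restrict (?q \<circ> s) J) J = s" if "s \<in> {s \<in> U. s i = b}" for s
      using that ext[of s] sH[of s] pq by (auto simp: fun_eq_iff extensional_def)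
  qed
  show "card {s \<in> U. s i = a} = card {s \<in> U. s i = b}"
    using bij by (rule bij_betw_same_card)
  have "prob {\<omega> \<in> space M. X \<omega> \<in> rank_event J k i s}
      = prob {\<omega> \<in> space M. X \<omega> \<in> rank_event J k i (restrict (p \<circ> s) J)}" if s: "s \<in> U" for s
  proof -
    \<comment> \<open>First all entries are translated by \<open>g\<close>, then each
      \<open>s j \<odot> g\<close> is replaced by the representative \<open>p (s j)\<close> of its
      class.\<close>
    have "prob {\<omega> \<in> space M. X \<omega> \<in> rank_event J k i s}
        = prob {\<omega> \<in> space M. X \<omega> \<in> rank_event J k i (\<lambda>j. s j \<odot> g)}"
      using sH[OF s] H(1) by (intro prob_rank_event_translate[symmetric] J p) auto
    also have "\<dots> = prob {\<omega> \<in> space M. X \<omega> \<in> rank_event J k i (restrict (p \<circ> s) J)}"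
      using p(4) sH[OF s] equiv_R
      by (intro prob_rank_event_cong J) (auto simp: equiv_def dest: symD)
    finally show ?thesis .
  qed
  then have "(\<Sum>s | s \<in> U \<and> s i = a. prob {\<omega> \<in> space M. X \<omega> \<in> rank_event J k i s})
      = (\<Sum>s | s \<in> U \<and> s i = a. prob {\<omega> \<in> space M. X \<omega> \<in> rank_event J k i (restrict (p \<circ> s) J)})"
    by (intro sum.cong) auto
  also have "\<dots> = (\<Sum>s | s \<in> U \<and> s i = b. prob {\<omega> \<in> space M. X \<omega> \<in> rank_event J k i s})"
    by (rule sum.reindex_bij_betw[OF bij])
  finally show "(\<Sum>s | s \<in> U \<and> s i = a. prob {\<omega> \<in> space M. X \<omega> \<in> rank_event J k i s})
       = (\<Sum>s | s \<in> U \<and> s i = b. prob {\<omega> \<in> space M. X \<omega> \<in> rank_event J k i s})" .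
qed

text \<open>All base values contribute equally, so \<open>F\<close> can be found by summing over the
  whole of \<open>U\<close>. That sum is the expected number of tuples whose position
  \<open>i\<close> has rank at least \<open>k\<close>, and position symmetry reduces it to the rank
  count in single tuples.\<close>

lemma sum_prob_rank_event:
  fixes F :: real
  assumes H: "H \<subseteq> G" "\<And>a. a \<in> G \<Longrightarrow> \<exists>!b. b \<in> H \<and> (a, b) \<in> R"
    and J: "finite J" "i \<in> J" and U: "symmetric_tuples J H U" and b: "b \<in> H"
    and F: "F = (\<Sum>s | s \<in> U \<and> s i = b. prob {\<omega> \<in> space M. X \<omega> \<in> rank_event J k i s})"
  shows "F * card J \<le> card {s \<in> U. s i = b} * real (card J - k)"
    and "U \<subseteq> injective_tuples J H \<Longrightarrow> F * card J = card {s \<in> U. s i = b} * real (card J - k)"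
proof -
  have finH: "finite H" using H(1) finite_G by (rule finite_subset)
  have cH: "card H > 0" using finH b by (auto simp: card_gt_0_iff)
  have sub: "U \<subseteq> J \<rightarrow>\<^sub>E H" using U by (simp add: symmetric_tuples_def)
  have finU: "finite U" using sub J finH by (auto intro: finite_subset finite_PiE)
  have sG: "s j \<in> G" if "s \<in> U" "j \<in> J" for s j using sub that H(1) by auto
  let ?E = "\<lambda>s. {\<omega> \<in> space M. X \<omega> \<in> rank_event J k i s}"
  let ?N = "\<lambda>\<omega> s. card {j \<in> J. k \<le> card {l \<in> J. T (s l (X \<omega>)) < T (s j (X \<omega>))}}"
  have split: "(\<Sum>s\<in>U. f s) = (\<Sum>a\<in>H. \<Sum>s | s \<in> U \<and> s i = a. f s)" for f :: "_ \<Rightarrow> real"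
    by (rule sum.group[symmetric]) (use finU finH sub J in auto)
  \<comment> \<open>Grouped by base value, \<open>U\<close> splits into \<open>card H\<close> parts,
    each with the same sum \<open>F\<close>.\<close>
  have sumU: "(\<Sum>s\<in>U. prob (?E s)) = card H * F"
    unfolding split F using sum_prob_rank_event_base(1)[OF H J U _ b] by simp
  have "real (card U) = (\<Sum>a\<in>H. real (card {s \<in> U. s i = a}))"
    using split[of "\<lambda>_. 1"] by simp
  then have cardU: "real (card U) = card H * real (card {s \<in> U. s i = b})"
    using sum_prob_rank_event_base(2)[OF H J U _ b] by simp
  have E: "?E s \<in> events" if "s \<in> U" for s
    using sG[OF that] J by (intro events_rank_event)
  have "(\<Sum>s\<in>U. prob (?E s)) = (\<Sum>s\<in>U. expectation (indicator (?E s)))"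
    using E by (intro sum.cong) auto
  also have "\<dots> = expectation (\<lambda>\<omega>. \<Sum>s\<in>U. indicator (?E s) \<omega>)"
    using E by (intro Bochner_Integration.integral_sum[symmetric]) (auto intro: integrable_real_indicator simp: emeasure_eq_measure)
  finally have expect: "(\<Sum>s\<in>U. prob (?E s)) = expectation (\<lambda>\<omega>. \<Sum>s\<in>U. indicator (?E s) \<omega>)" .
  have int: "integrable M (\<lambda>\<omega>. \<Sum>s\<in>U. indicator (?E s) \<omega> :: real)"
    using E by (intro Bochner_Integration.integrable_sum) (auto intro: integrable_real_indicator simp: emeasure_eq_measure)
  \<comment> \<open>With the outcome fixed, \<open>card_tuples_rank_ge\<close> applies to the
    deterministic values \<open>T (a (X \<omega>))\<close>.\<close>
  have count: "(\<Sum>s\<in>U. indicator (?E s) \<omega> :: real) * card J = (\<Sum>s\<in>U. real (?N \<omega> s))"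
    if \<omega>: "\<omega> \<in> space M" for \<omega>
  proof -
    have "(\<Sum>s\<in>U. indicator (?E s) \<omega> :: real) = card {s \<in> U. k \<le> card {l \<in> J. T (s l (X \<omega>)) < T (s i (X \<omega>))}}"
      using finU \<omega> by (simp add: indicator_def X_in_rank_event sum.If_cases Int_def)
    then have "(\<Sum>s\<in>U. indicator (?E s) \<omega> :: real) * card J
        = real (card {s \<in> U. k \<le> card {l \<in> J. T (s l (X \<omega>)) < T (s i (X \<omega>))}} * card J)"
      by (simp only: of_nat_mult)
    also have "\<dots> = real (\<Sum>s\<in>U. ?N \<omega> s)"
      by (subst card_tuples_rank_ge[OF J finH U, where v = "\<lambda>a. T (a (X \<omega>))" and k = k]) (rule refl)
    finally show ?thesis by (simp only: of_nat_sum)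
  qed
  have "expectation (\<lambda>\<omega>. (\<Sum>s\<in>U. indicator (?E s) \<omega>) * real (card J)) \<le> expectation (\<lambda>\<omega>. real (card U) * real (card J - k))"
  proof (rule integral_mono)
    fix \<omega> assume \<omega>: "\<omega> \<in> space M"
    have "(\<Sum>s\<in>U. real (?N \<omega> s)) \<le> (\<Sum>s\<in>U. real (card J - k))"
      using card_ranks_ge_le[OF J(1)] by (intro sum_mono) (simp only: of_nat_le_iff)
    then show "(\<Sum>s\<in>U. indicator (?E s) \<omega>) * real (card J) \<le> real (card U) * real (card J - k)"
      using count[OF \<omega>] by simp
  qed (use int in auto)
  \<comment> \<open>The factor \<open>card H\<close> stems on the left from the equal base values
    and on the right from \<open>card U\<close>, so it cancels.\<close>
  then have "card H * (F * card J) \<le> card H * (card {s \<in> U. s i = b} * real (card J - k))"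
    by (simp add: expect[symmetric] sumU cardU prob_space mult.assoc)
  then show "F * card J \<le> card {s \<in> U. s i = b} * real (card J - k)"
    using cH by simp
  show "F * card J = card {s \<in> U. s i = b} * real (card J - k)" if inj: "U \<subseteq> injective_tuples J H"
  proof -
    have "expectation (\<lambda>\<omega>. (\<Sum>s\<in>U. indicator (?E s) \<omega>) * real (card J)) = expectation (\<lambda>\<omega>. real (card U) * real (card J - k))"
    proof (rule integral_cong_AE)
      show "AE \<omega> in M. (\<Sum>s\<in>U. indicator (?E s) \<omega>) * real (card J) = real (card U) * real (card J - k)"
        using ties AE_space
      proof eventually_elim
        case (elim \<omega>)
        \<comment> \<open>An injective tuple has different representatives at different positions;
          these lie in different classes, so outside a null set there are no ties and
          \<open>card_ranks_ge_eq\<close> applies.\<close>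
        have "inj_on (\<lambda>j. T (s j (X \<omega>))) J" if s: "s \<in> U" for s
        proof (rule inj_onI)
          fix j l assume jl: "j \<in> J" "l \<in> J" "T (s j (X \<omega>)) = T (s l (X \<omega>))"
          have HG: "s j \<in> H" "s l \<in> H" "s j \<in> G" "s l \<in> G" using sub s jl sG by auto
          then have "(s j, s l) \<in> R" using elim jl by blast
          moreover have "(s j, s j) \<in> R" using equiv_R HG by (auto simp: equiv_def dest: refl_onD)
          ultimately have "s j = s l" using H(2)[of "s j"] HG by blast
          then show "j = l" using inj s jl by (auto simp: injective_tuples_def dest: inj_onD)
        qed
        then have "(\<Sum>s\<in>U. real (?N \<omega> s)) = (\<Sum>s\<in>U. real (card J - k))"
          using card_ranks_ge_eq[OF J(1)] by (intro sum.cong) (simp_all only:)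
        then show ?case using count elim by simp
      qed
    qed (use int in \<open>auto intro!: borel_measurable_integrable\<close>)
    then have "card H * (F * card J) = card H * (card {s \<in> U. s i = b} * real (card J - k))"
      by (simp add: expect[symmetric] sumU cardU prob_space mult.assoc)
    then show ?thesis using cH by simp
  qed
qed

section \<open>Ranks for a random tuple\<close>

text \<open>Conditioning on the draw leaves fixed tuples with the identity at position
  \<open>i\<close>. The identity may be replaced by its representative \<open>b\<close>, after which
  the tuples are exactly those of \<open>U\<close> with base value \<open>b\<close>.\<close>

lemma prob_rank_of_draw:
  fixes P :: real
  assumes H: "H \<subseteq> G" "\<And>a. a \<in> G \<Longrightarrow> \<exists>!b. b \<in> H \<and> (a, b) \<in> R"
    and b: "b \<in> H" "((\<lambda>x\<in>space S. x), b) \<in> R"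
    and J: "finite J" "i \<notin> J"
    and indep: "indep_random_elements M S X (\<Pi>\<^sub>M j\<in>J. count_space G) Y"
    and D: "D \<subseteq> J \<rightarrow>\<^sub>E H" "\<And>\<omega>. \<omega> \<in> space M \<Longrightarrow> Y \<omega> \<in> D"
    and unif: "\<And>t. t \<in> D \<Longrightarrow> prob {\<omega> \<in> space M. Y \<omega> = t} = 1 / card D"
    and U: "symmetric_tuples (insert i J) H U" "(\<lambda>t. t(i := b)) ` D = {s \<in> U. s i = b}"
    and P: "P = prob {\<omega> \<in> space M. k \<le> card {j \<in> insert i J.
              T (((Y \<omega>)(i := \<lambda>x\<in>space S. x)) j (X \<omega>)) < T (X \<omega>)}}"
  shows "P * card (insert i J) \<le> real (card (insert i J) - k)"
    and "U \<subseteq> injective_tuples (insert i J) H \<Longrightarrow> P * card (insert i J) = real (card (insert i J) - k)"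
proof -
  let ?id = "\<lambda>x\<in>space S. x" and ?I = "insert i J"
  have finI: "finite ?I" "i \<in> ?I" using J by auto
  have finD: "finite D"
    using D(1) J(1) finite_subset[OF H(1) finite_G] by (auto intro: finite_subset finite_PiE)
  have id_G: "?id \<in> G" using b(2) equiv_R by (auto simp: equiv_def refl_on_def)
  have refl_R: "(a, a) \<in> R" if "a \<in> G" for a
    using equiv_R that by (auto simp: equiv_def dest: refl_onD)
  have cD: "card D > 0" using finD D(2) not_empty by (auto simp: card_gt_0_iff)
  have tG: "t j \<in> G" if "t \<in> D" "j \<in> J" for t j using D(1) H(1) that by auto
  have inj: "inj_on (\<lambda>t. t(i := b)) D"
  proof (rule inj_onI)
    fix t t' assume t: "t \<in> D" "t' \<in> D" "t(i := b) = t'(i := b)"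
    \<comment> \<open>Extensional tuples carry the default value outside \<open>J\<close>, so
      overwriting position \<open>i\<close> loses no information.\<close>
    then have "t i = undefined" "t' i = undefined" using D(1) J(2) by (auto simp: PiE_iff extensional_def)
    then show "t = t'" using t(3) by (metis fun_upd_triv fun_upd_upd)
  qed
  have "P = prob {\<omega> \<in> space M. X \<omega> \<in> rank_event ?I k i ((Y \<omega>)(i := ?id))}"
    unfolding P
  proof (intro arg_cong[where f = prob] Collect_cong conj_cong refl)
    fix \<omega> assume \<omega>: "\<omega> \<in> space M"
    have "T (((Y \<omega>)(i := ?id)) i (X \<omega>)) = T (X \<omega>)" using measurable_space[OF X \<omega>] by simp
    then show "(k \<le> card {j \<in> ?I. T (((Y \<omega>)(i := ?id)) j (X \<omega>)) < T (X \<omega>)})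
        = (X \<omega> \<in> rank_event ?I k i ((Y \<omega>)(i := ?id)))"
      by (simp only: X_in_rank_event[OF \<omega>])
  qed
  also have "\<dots> = (\<Sum>t\<in>D. prob {\<omega> \<in> space M. X \<omega> \<in> rank_event ?I k i (t(i := ?id))}) / card D"
  proof (rule prob_independent_uniform_draw[OF indep finD D(2) _ unif])
    fix t assume t: "t \<in> D"
    have "{t} = PiE J (\<lambda>j. {t j})" using t D(1) by (intro PiE_singleton[symmetric]) (auto simp: PiE_iff)
    also have "\<dots> \<in> sets (\<Pi>\<^sub>M j\<in>J. count_space G)"
      using tG[OF t] J(1) by (intro sets_PiM_I_finite) auto
    finally show "{t} \<in> sets (\<Pi>\<^sub>M j\<in>J. count_space G)" .
    show "rank_event ?I k i (t(i := ?id)) \<in> sets S"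
      using tG[OF t] id_G finI by (intro sets_rank_event) auto
  qed auto
  also have "(\<Sum>t\<in>D. prob {\<omega> \<in> space M. X \<omega> \<in> rank_event ?I k i (t(i := ?id))})
      = (\<Sum>t\<in>D. prob {\<omega> \<in> space M. X \<omega> \<in> rank_event ?I k i (t(i := b))})"
    \<comment> \<open>Only position \<open>i\<close> changes, from the identity to \<open>b\<close>
      in the same class.\<close>
    using b(2) refl_R tG finI by (intro sum.cong refl prob_rank_event_cong) auto
  also have "\<dots> = (\<Sum>s | s \<in> U \<and> s i = b. prob {\<omega> \<in> space M. X \<omega> \<in> rank_event ?I k i s})"
    unfolding U(2)[symmetric] by (simp add: sum.reindex[OF inj])
  finally have F: "P * card D = (\<Sum>s | s \<in> U \<and> s i = b. prob {\<omega> \<in> space M. X \<omega> \<in> rank_event ?I k i s})"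
    using cD by simp
  have card_eq: "card {s \<in> U. s i = b} = card D"
    using card_image[OF inj] U(2) by simp
  have "card D * (P * card ?I) \<le> card D * real (card ?I - k)"
    using sum_prob_rank_event(1)[OF H finI U(1) b(1) F] by (simp add: card_eq mult_ac)
  then show "P * card ?I \<le> real (card ?I - k)" using cD by simp
  show "P * card ?I = real (card ?I - k)" if "U \<subseteq> injective_tuples ?I H"
  proof -
    have "card D * (P * card ?I) = card D * real (card ?I - k)"
      using sum_prob_rank_event(2)[OF H finI U(1) b(1) F that] by (simp add: card_eq mult_ac)
    then show ?thesis using cD by simp
  qed
qed

end

section \<open>The two sampling schemes\<close>

lemma image_upd_PiE:
  assumes "i \<notin> J" "b \<in> H"
  shows "(\<lambda>t. t(i := b)) ` (J \<rightarrow>\<^sub>E H) = {s \<in> insert i J \<rightarrow>\<^sub>E H. s i = b}"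
proof (intro equalityI subsetI)
  fix s assume s: "s \<in> {s \<in> insert i J \<rightarrow>\<^sub>E H. s i = b}"
  then have "s = (restrict s J)(i := b)" by (auto simp: fun_eq_iff PiE_iff extensional_def)
  moreover have "restrict s J \<in> J \<rightarrow>\<^sub>E H" using s by auto
  ultimately show "s \<in> (\<lambda>t. t(i := b)) ` (J \<rightarrow>\<^sub>E H)" by blast
qed (use assms in \<open>auto simp: PiE_iff extensional_def\<close>)

text \<open>A fixed value \<open>b\<close> at position \<open>i\<close> excludes \<open>b\<close>
  from all other positions of an injective tuple. This matches scheme (ii), which draws only from
  the remaining representatives.\<close>

lemma image_upd_injective_tuples:
  assumes "i \<notin> J" "b \<in> H"
  shows "(\<lambda>t. t(i := b)) ` injective_tuples J (H - {b}) = {s \<in> injective_tuples (insert i J) H. s i = b}"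
proof (intro equalityI subsetI)
  fix s assume s: "s \<in> {s \<in> injective_tuples (insert i J) H. s i = b}"
  then have "s = (restrict s J)(i := b)"
    by (auto simp: injective_tuples_def fun_eq_iff PiE_iff extensional_def)
  moreover have "restrict s J \<in> injective_tuples J (H - {b})"
    using s assms by (auto simp: injective_tuples_def inj_on_def)
  ultimately show "s \<in> (\<lambda>t. t(i := b)) ` injective_tuples J (H - {b})" by blast
next
  fix s assume "s \<in> (\<lambda>t. t(i := b)) ` injective_tuples J (H - {b})"
  then obtain t where t: "s = t(i := b)" "t \<in> J \<rightarrow>\<^sub>E H - {b}" "inj_on t J"
    by (auto simp: injective_tuples_def)
  have "inj_on s (insert i J)"
    using t assms by (auto simp: inj_on_def PiE_iff)
  moreover have "s \<in> insert i J \<rightarrow>\<^sub>E H" using t assms by (auto simp: PiE_iff extensional_def)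
  ultimately show "s \<in> {s \<in> injective_tuples (insert i J) H. s i = b}"
    using t by (simp add: injective_tuples_def)
qed

lemma (in prob_space) drawn_with_replacementD:
  assumes g: "drawn_with_replacement M H J g" and fin: "finite H" "finite J"
  shows "\<omega> \<in> space M \<Longrightarrow> (\<lambda>j\<in>J. g j \<omega>) \<in> J \<rightarrow>\<^sub>E H"
    and "t \<in> J \<rightarrow>\<^sub>E H \<Longrightarrow> prob {\<omega> \<in> space M. (\<lambda>j\<in>J. g j \<omega>) = t} = 1 / card (J \<rightarrow>\<^sub>E H)"
proof -
  have ind: "indep_vars (\<lambda>_. count_space H) g J"
    and distr: "\<And>j. j \<in> J \<Longrightarrow> distr M (count_space H) (g j) = uniform_count_measure H"
    using g by (auto simp: drawn_with_replacement_def)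
  have meas: "g j \<in> measurable M (count_space H)" if "j \<in> J" for j
    using ind that by (auto simp: indep_vars_def)
  show "(\<lambda>j\<in>J. g j \<omega>) \<in> J \<rightarrow>\<^sub>E H" if "\<omega> \<in> space M"
    using measurable_space[OF meas that] by auto
  show "prob {\<omega> \<in> space M. (\<lambda>j\<in>J. g j \<omega>) = t} = 1 / card (J \<rightarrow>\<^sub>E H)" if t: "t \<in> J \<rightarrow>\<^sub>E H"
  \<comment> \<open>The case of an empty \<open>J\<close> arises for \<open>w = 1\<close>, where
    there is nothing to draw; the product formula for independent variables is applied to nonempty
    \<open>J\<close>.\<close>
  proof (cases "J = {}")
    case True
    then have "{\<omega> \<in> space M. (\<lambda>j\<in>J. g j \<omega>) = t} = space M" using t by (auto simp: restrict_def)
    then show ?thesis using True by (simp add: prob_space)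
  next
    case False
    have "{\<omega> \<in> space M. (\<lambda>j\<in>J. g j \<omega>) = t} = (\<Inter>j\<in>J. g j -` {t j} \<inter> space M)"
      using t False by (auto simp: fun_eq_iff PiE_iff extensional_def restrict_def)
    also have "prob \<dots> = (\<Prod>j\<in>J. prob (g j -` {t j} \<inter> space M))"
      using t False fin by (intro indep_varsD[OF ind]) auto
    also have "\<dots> = (\<Prod>j\<in>J. 1 / card H)"
    proof (rule prod.cong[OF refl])
      fix j assume j: "j \<in> J"
      have "prob (g j -` {t j} \<inter> space M) = measure (distr M (count_space H) (g j)) {t j}"
        using t j by (intro measure_distr[symmetric] meas) auto
      also have "\<dots> = 1 / card H"
        using t j fin by (subst distr[OF j], subst measure_uniform_count_measure) auto
      finally show "prob (g j -` {t j} \<inter> space M) = 1 / card H" .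
    qed
    also have "\<dots> = 1 / card (J \<rightarrow>\<^sub>E H)"
      using fin by (simp add: card_PiE power_one_over)
    finally show ?thesis .
  qed
qed

lemma (in prob_space) drawn_without_replacementD:
  assumes g: "drawn_without_replacement M H J g" and fin: "finite H" "finite J"
  shows "\<omega> \<in> space M \<Longrightarrow> (\<lambda>j\<in>J. g j \<omega>) \<in> injective_tuples J H"
    and "t \<in> injective_tuples J H \<Longrightarrow>
      prob {\<omega> \<in> space M. (\<lambda>j\<in>J. g j \<omega>) = t} = 1 / card (injective_tuples J H)"
proof -
  let ?D = "injective_tuples J H"
  have meas: "(\<lambda>\<omega>. \<lambda>j\<in>J. g j \<omega>) \<in> measurable M (count_space ?D)"
    and distr: "distr M (count_space ?D) (\<lambda>\<omega>. \<lambda>j\<in>J. g j \<omega>) = uniform_count_measure ?D"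
    using g by (auto simp: drawn_without_replacement_def)
  show "(\<lambda>j\<in>J. g j \<omega>) \<in> ?D" if "\<omega> \<in> space M"
    using measurable_space[OF meas that] by simp
  have finD: "finite ?D"
    by (rule finite_subset[of _ "J \<rightarrow>\<^sub>E H"]) (use fin in \<open>auto simp: injective_tuples_def intro: finite_PiE\<close>)
  show "prob {\<omega> \<in> space M. (\<lambda>j\<in>J. g j \<omega>) = t} = 1 / card ?D" if t: "t \<in> ?D"
  proof -
    have "{\<omega> \<in> space M. (\<lambda>j\<in>J. g j \<omega>) = t} = (\<lambda>\<omega>. \<lambda>j\<in>J. g j \<omega>) -` {t} \<inter> space M" by auto
    also have "prob \<dots> = measure (distr M (count_space ?D) (\<lambda>\<omega>. \<lambda>j\<in>J. g j \<omega>)) {t}"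
      using t by (intro measure_distr[symmetric] meas) auto
    also have "\<dots> = 1 / card ?D"
      unfolding distr using t finD by (subst measure_uniform_count_measure) auto
    finally show ?thesis .
  qed
qed

(* BijGroup (space S) represents a self-map of the sample space by a function that is undefined
   outside of it; hence the identity transformation is the restriction of the identity. *)
theorem proposition2:
  fixes M :: "'w measure"
    and S :: "'x measure"
    and X :: "'w \<Rightarrow> 'x"
    and G :: "('x \<Rightarrow> 'x) set"
    and T :: "'x \<Rightarrow> real"
    and m w :: nat
    and Gs :: "nat \<Rightarrow> ('x \<Rightarrow> 'x) set"
    and h :: "nat \<Rightarrow> 'x \<Rightarrow> 'x"
    and g :: "nat \<Rightarrow> 'w \<Rightarrow> 'x \<Rightarrow> 'x"
  assumes "prob_space M"
    and "X \<in> measurable M S"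
    and "finite G"
    and "subgroup G (BijGroup (space S))"
    and "\<And>a. a \<in> G \<Longrightarrow> a \<in> measurable S S"
    and "T \<in> borel_measurable S"
    and "null_hypothesis M X G T"
    and "partition_on G (Gs ` {1..m})"
    and "inj_on Gs {1..m}"
    and "(\<lambda>x\<in>space S. x) \<in> Gs 1"
    and "\<And>i. i \<in> {1..m} \<Longrightarrow> card (Gs i) = card (Gs 1)"
    and "AE \<omega> in M. \<forall>a\<in>G. \<forall>b\<in>G.
           T (a (X \<omega>)) = T (b (X \<omega>)) \<longleftrightarrow> (\<exists>i\<in>{1..m}. a \<in> Gs i \<and> b \<in> Gs i)"
    and "\<And>i. i \<in> {1..m} \<Longrightarrow> h i \<in> Gs i"
    and "w \<ge> 1"
    and "\<And>\<omega>. \<omega> \<in> space M \<Longrightarrow> g 1 \<omega> = (\<lambda>x\<in>space S. x)"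
    and "indep_random_elements M S X
           (\<Pi>\<^sub>M j\<in>{2..w}. count_space G) (\<lambda>\<omega>. \<lambda>j\<in>{2..w}. g j \<omega>)"
  shows "(drawn_with_replacement M (h ` {1..m}) {2..w} g \<or>
            w \<le> m \<and> drawn_without_replacement M (h ` {2..m}) {2..w} g \<longrightarrow>
          (\<forall>\<alpha>\<in>{0..<1}.
             measure M {\<omega> \<in> space M. rejects T \<alpha> (map (\<lambda>j. g j \<omega>) [1..<Suc w]) (X \<omega>)} \<le> \<alpha>)) \<and>
         (w \<le> m \<and> drawn_without_replacement M (h ` {2..m}) {2..w} g \<longrightarrow>
          (\<forall>\<alpha>\<in>{real i / real w | i. i < w}.
             measure M {\<omega> \<in> space M. rejects T \<alpha> (map (\<lambda>j. g j \<omega>) [1..<Suc w]) (X \<omega>)} = \<alpha>))"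
proof -
  define R where "R = {(a, b). \<exists>p\<in>Gs ` {1..m}. a \<in> p \<and> b \<in> p}"
  have equiv: "equiv G R"
    unfolding R_def using assms(8) by (rule equiv_partition_on)
  have R_iff: "(a, b) \<in> R \<longleftrightarrow> (\<exists>i\<in>{1..m}. a \<in> Gs i \<and> b \<in> Gs i)" for a b
    by (auto simp: R_def)
  interpret tied_invariant_statistic M S X G T R
    using assms(1-7,12) equiv
    by (simp add: tied_invariant_statistic_def tied_invariant_statistic_axioms_def R_iff)
  let ?id = "\<lambda>x\<in>space S. x" and ?H = "h ` {1..m}" and ?Y = "\<lambda>\<omega>. \<lambda>j\<in>{2..w}. g j \<omega>"
  have cover: "G = (\<Union>i\<in>{1..m}. Gs i)" using partition_onD1[OF assms(8)] by simp
  have disj: "i = j" if "i \<in> {1..m}" "j \<in> {1..m}" "a \<in> Gs i" "a \<in> Gs j" for i j a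
  proof -
    have "Gs i = Gs j"
      using disjointD[OF partition_onD2[OF assms(8)], of "Gs i" "Gs j"] that by blast
    then show ?thesis using assms(9) that by (auto dest: inj_onD)
  qed
  have "m \<ge> 1"
  proof -
    have "G \<noteq> {}" using subgroup.one_closed[OF assms(4)] by auto
    then show ?thesis using cover by (cases m) auto
  qed
  have inj_h: "inj_on h {1..m}"
    using disj assms(13) by (metis inj_onI)
  have H: "?H \<subseteq> G" using cover assms(13) by auto
  have transversal: "\<exists>!b. b \<in> ?H \<and> (a, b) \<in> R" if a: "a \<in> G" for a
  proof -
    obtain i where i: "i \<in> {1..m}" "a \<in> Gs i" using a cover by auto
    show ?thesis
    proof (rule ex1I[of _ "h i"])
      show "h i \<in> ?H \<and> (a, h i) \<in> R" using i assms(13) by (auto simp: R_iff)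
      fix b assume b: "b \<in> ?H \<and> (a, b) \<in> R"
      then obtain l n where l: "l \<in> {1..m}" "b = h l" "n \<in> {1..m}" "a \<in> Gs n" "b \<in> Gs n"
        by (auto simp: R_iff)
      then have "n = i" "n = l" using disj[of n i a] disj[of n l b] i assms(13) by auto
      then show "b = h i" using l by simp
    qed
  qed
  have h1: "h 1 \<in> ?H" "(?id, h 1) \<in> R"
    using \<open>m \<ge> 1\<close> assms(10) assms(13)[of 1] by (auto simp: R_iff)
  \<comment> \<open>Injectivity of \<open>h\<close> ensures that removing \<open>h 1\<close> removes
    just the index 1.\<close>
  have H_diff: "?H - {h 1} = h ` {2..m}"
  proof -
    have "{2..m} = {1..m} - {1}" by auto
    then show ?thesis using inj_on_image_set_diff[OF inj_h, of "{1..m}" "{1}"] \<open>m \<ge> 1\<close> by auto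
  qed
  have I: "insert 1 {2..w} = {1..w}" using assms(14) by auto
  have card_I: "card (insert 1 {2..w}) = w" unfolding I by simp
  define k where "k \<alpha> = nat \<lceil>(1 - \<alpha>) * real w\<rceil>" for \<alpha>
  define P where "P \<alpha> = measure M {\<omega> \<in> space M. rejects T \<alpha> (map (\<lambda>j. g j \<omega>) [1..<Suc w]) (X \<omega>)}" for \<alpha>
  \<comment> \<open>\<open>?Y\<close> is undefined at 1; writing the identity there restores the
    full tuple, since \<open>g 1\<close> is the identity.\<close>
  have P: "P \<alpha> = prob {\<omega> \<in> space M. k \<alpha> \<le> card {j \<in> insert 1 {2..w}.
      T (((?Y \<omega>)(1 := ?id)) j (X \<omega>)) < T (X \<omega>)}}" if "\<alpha> \<in> {0..<1}" for \<alpha>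
    unfolding P_def
  proof (intro arg_cong[where f = prob] Collect_cong conj_cong refl)
    fix \<omega> assume "\<omega> \<in> space M"
    then have "((?Y \<omega>)(1 := ?id)) j = g j \<omega>" if "j \<in> {1..w}" for j
      using assms(15) that by auto
    then have "{j \<in> {1..w}. T (((?Y \<omega>)(1 := ?id)) j (X \<omega>)) < T (X \<omega>)} =
        {j \<in> {1..w}. T (g j \<omega> (X \<omega>)) < T (X \<omega>)}"
      by (simp only: cong: conj_cong)
    then show "rejects T \<alpha> (map (\<lambda>j. g j \<omega>) [1..<Suc w]) (X \<omega>) =
        (k \<alpha> \<le> card {j \<in> insert 1 {2..w}. T (((?Y \<omega>)(1 := ?id)) j (X \<omega>)) < T (X \<omega>)})"
      unfolding rejects_iff[OF that assms(14)] I k_def by (simp only:)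
  qed
  note rank = prob_rank_of_draw[OF H transversal h1 finite_atLeastAtMost _ assms(16), where i = 1]
  \<comment> \<open>Here \<open>U\<close> consists of all tuples of representatives on
    \<open>{1..w}\<close>, and the draw is uniform on all those on \<open>{2..w}\<close>.\<close>
  have with_repl: "P \<alpha> * w \<le> real (w - k \<alpha>)"
    if "drawn_with_replacement M ?H {2..w} g" "\<alpha> \<in> {0..<1}" for \<alpha>
    using rank(1)[OF _ _ subset_refl _ _ symmetric_tuples_PiE image_upd_PiE P[OF that(2)], unfolded card_I]
      drawn_with_replacementD[OF that(1)] h1(1) by simp
  \<comment> \<open>Here \<open>U\<close> consists of the injective tuples on \<open>{1..w}\<close>,
    and the draw is uniform on the injective tuples on \<open>{2..w}\<close> avoiding
    \<open>h 1\<close>.\<close>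
  have without: "P \<alpha> * w = real (w - k \<alpha>)"
    if "drawn_without_replacement M (h ` {2..m}) {2..w} g" "\<alpha> \<in> {0..<1}" for \<alpha>
  proof -
    have "injective_tuples {2..w} (?H - {h 1}) \<subseteq> {2..w} \<rightarrow>\<^sub>E ?H"
      by (auto simp: injective_tuples_def)
    from rank(2)[OF _ _ this _ _ symmetric_tuples_injective image_upd_injective_tuples P[OF that(2)], unfolded card_I H_diff]
    show ?thesis
      using drawn_without_replacementD[OF that(1)] h1(1) by simp
  qed
  \<comment> \<open>Rounding up makes \<open>k \<alpha>\<close> at least
    \<open>(1 - \<alpha>) * w\<close>, leaving at most \<open>\<alpha> * w\<close> positions;
    \<open>k \<alpha> \<le> w\<close> makes the truncated subtraction a true one.\<close>
  have level: "P \<alpha> \<le> \<alpha>" if "P \<alpha> * w \<le> real (w - k \<alpha>)" "\<alpha> \<in> {0..<1}" for \<alpha>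
  proof -
    have "(1 - \<alpha>) * w \<le> k \<alpha>" unfolding k_def by linarith
    moreover have "k \<alpha> \<le> w"
    proof -
      have "(1 - \<alpha>) * w \<le> w" using that by (simp add: algebra_simps)
      then show ?thesis unfolding k_def by linarith
    qed
    ultimately have "real (w - k \<alpha>) \<le> \<alpha> * w" by (simp add: of_nat_diff algebra_simps)
    with that(1) have "P \<alpha> * w \<le> \<alpha> * w" by linarith
    then show ?thesis using assms(14) by simp
  qed
  \<comment> \<open>At these levels \<open>(1 - \<alpha>) * w\<close> is the integer
    \<open>w - i\<close>, so rounding up loses nothing and exactly \<open>i\<close> positions
    remain.\<close>
  have exact: "P (i / w) = i / w" if "drawn_without_replacement M (h ` {2..m}) {2..w} g" "i < w" for i
  proof -
    have "(1 - real i / w) * w = real (w - i)" using that(2) by (simp add: field_simps of_nat_diff)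
    then have "k (i / w) = w - i" by (simp add: k_def)
    moreover have "real i / w \<in> {0..<1}" using that(2) by simp
    ultimately have "P (i / w) * w = i" using without[OF that(1), of "i / w"] that(2) by simp
    then show ?thesis using that(2) by (simp add: field_simps)
  qed
  show ?thesis
    unfolding P_def[symmetric] using with_repl without level exact by fastforce
qed

end
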